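(* Let $p\in\mathbb{R}$. The inequality $$T(a,b)<A_p(a,b)$$ holds for all $a,b>0$ with $a\neq b$ if and only if $p\geq 5/3$. Moreover, for all $a,b>0$ with $a\neq b$, $$\alpha_1 A_{5/3}(a,b)<T(a,b)<\alpha_2 A_{5/3}(a,b),$$ where $\alpha_1=2^{8/5}\pi^{-1}$ and $\alpha_2=1$ are the best possible constants (that is, $\alpha_1$ cannot be replaced by a larger constant and $\alpha_2$ cannot be replaced by a smaller constant).
   Context: For $a,b>0$ with $a\neq b$, the second Seiffert mean is $$T(a,b)=\frac{a-b}{2\arctan\frac{a-b}{a+b}}.$$ The power mean of order $r\in\mathbb{R}$ is $A_r(a,b)=\left(\frac{a^r+b^r}{2}\right)^{1/r}$ if $r\neq 0$, and $A_0(a,b)=\sqrt{ab}$. *)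

theory Defs
  imports "HOL-Analysis.Analysis"
begin

(* Only meaningful for a, b > 0 with a \<noteq> b; at a = b the term below is 0 / 0 = 0. *)
definition second_seiffert_mean :: "real \<Rightarrow> real \<Rightarrow> real" where
  "second_seiffert_mean a b = (a - b) / (2 * arctan ((a - b) / (a + b)))"

definition power_mean :: "real \<Rightarrow> real \<Rightarrow> real \<Rightarrow> real" where
  "power_mean r a b =
     (if r = 0 then sqrt (a * b) else ((a powr r + b powr r) / 2) powr (1 / r))"

end

theory Submission
  imports Defs "HOL-Real_Asymp.Real_Asymp"
begin

text \<open>
  Write \<open>T\<close> for the second Seiffert mean and \<open>A\<close> for the power mean of order \<open>5/3\<close>. Both are
  symmetric and homogeneous of degree one, so \<open>T / A\<close> is determined by its values at
  \<open>a = (1 + s)\<^sup>3\<close>, \<open>b = (1 - s)\<^sup>3\<close> with \<open>0 < s < 1\<close>. The cubes remove the fractional exponent inside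
  the power mean, since \<open>a powr (5/3) = (1 + s)\<^sup>5\<close>: with
  \<open>\<theta> = arctan ((3 s + s\<^sup>3) / (1 + 3 s\<^sup>2))\<close> one gets
  \<open>ln (A / T) = ln \<theta> + 3/5 ln (1 + 10 s\<^sup>2 + 5 s\<^sup>4) - ln (3 s + s\<^sup>3)\<close>.

  Everything about the constants follows from the strict monotonicity of this function on
  \<open>{0<..1}\<close> (\<open>log_ratio_strict_mono\<close>): it tends to \<open>0\<close> at \<open>0\<close>, and its value at \<open>1\<close> is
  \<open>ln (\<pi> / 2 powr (8/5))\<close>. Hence \<open>T / A\<close> lies strictly between \<open>2 powr (8/5) / \<pi>\<close> and \<open>1\<close>, and it
  comes arbitrarily close to both ends. For the monotonicity, the derivative has the form
  \<open>\<theta>' / \<theta>\<close> minus a rational function, so its sign is decided by comparing \<open>\<theta>\<close> with another rational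
  function (\<open>arctan_cubic_less\<close>). Differentiating that comparison eliminates the arctangent and leaves
  a polynomial all of whose factors are positive on \<open>(0, 1)\<close>.

  For the order \<open>p\<close>: if \<open>p \<ge> 5/3\<close>, power means increase with the order, so \<open>T < A\<close> gives the claim.
  If \<open>p < 5/3\<close>, the expansions \<open>T (1 + t) (1 - t) = 1 + t\<^sup>2/3 + o(t\<^sup>2)\<close> and
  \<open>power_mean p (1 + t) (1 - t) = 1 + (p - 1) t\<^sup>2/2 + o(t\<^sup>2)\<close> show that the inequality is reversed for
  small \<open>t\<close>; the two coefficients of \<open>t\<^sup>2\<close> agree exactly at \<open>p = 5/3\<close>.
\<close>

section \<open>Homogeneity, symmetry and monotonicity of the means\<close>

lemma second_seiffert_mean_scale:
  "second_seiffert_mean (k * a) (k * b) = k * second_seiffert_mean a b"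
proof (cases "k = 0")
  case False
  then have "(k * a - k * b) / (k * a + k * b) = (a - b) / (a + b)"
    by (simp flip: right_diff_distrib distrib_left)
  then show ?thesis
    by (simp add: second_seiffert_mean_def right_diff_distrib)
qed (simp add: second_seiffert_mean_def)

lemma second_seiffert_mean_commute: "second_seiffert_mean a b = second_seiffert_mean b a"
proof -
  have "(b - a) / (b + a) = - ((a - b) / (a + b))"
    by (simp add: add.commute minus_divide_left)
  then have "arctan ((b - a) / (b + a)) = - arctan ((a - b) / (a + b))"
    by (simp add: arctan_minus)
  then show ?thesis
    unfolding second_seiffert_mean_def by (metis minus_diff_eq minus_divide_divide mult_minus_right)
qed

lemma power_mean_scale:
  assumes "k > 0" "a > 0" "b > 0" "r \<noteq> 0"
  shows "power_mean r (k * a) (k * b) = k * power_mean r a b"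
proof -
  have "((k * a) powr r + (k * b) powr r) / 2 = k powr r * ((a powr r + b powr r) / 2)"
    using assms by (simp add: powr_mult distrib_left)
  then show ?thesis
    using assms powr_mult[of "k powr r" "(a powr r + b powr r) / 2" "1 / r"]
    by (simp only: power_mean_def) (simp add: powr_powr)
qed

lemma power_mean_commute: "power_mean r a b = power_mean r b a"
  by (simp add: power_mean_def add.commute mult.commute)

lemma power_mean_pos: "a > 0 \<Longrightarrow> b > 0 \<Longrightarrow> power_mean r a b > 0"
  by (simp add: power_mean_def add_pos_pos less_imp_neq[symmetric])

text \<open>This is the midpoint convexity of \<open>x powr (p / r)\<close> at \<open>a powr r\<close> and \<open>b powr r\<close>.\<close>

lemma power_mean_mono:
  assumes "0 < r" "r \<le> p" "a > 0" "b > 0"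
  shows "power_mean r a b \<le> power_mean p a b"
proof -
  define k where "k = p / r"
  have k: "k \<ge> 1" "r * k = p" "k \<noteq> 0" "k > 0"
    using assms by (auto simp: k_def)
  let ?m = "(a powr r + b powr r) / 2"
  have m: "?m > 0"
    using assms by (simp add: add_pos_pos)
  have "?m powr k \<le> ((a powr r) powr k + (b powr r) powr k) / 2"
    using convex_onD[OF powr_convex[OF k(1)], of "1/2" "a powr r" "b powr r"] assms
    by (simp add: field_simps)
  also have "\<dots> = (a powr p + b powr p) / 2"
    by (simp add: powr_powr k)
  finally have "(?m powr k) powr (1 / p) \<le> ((a powr p + b powr p) / 2) powr (1 / p)"
    using assms by (intro powr_mono2) auto
  moreover have "k * (1 / p) = 1 / r"
    using assms by (simp add: k_def)
  ultimately show ?thesis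
    using assms by (simp add: power_mean_def powr_powr)
qed

section \<open>Parametrisation by cubes\<close>

text \<open>
  With \<open>x\<close> and \<open>y\<close> the cube roots of \<open>a\<close> and \<open>b\<close>, take \<open>s = (x - y) / (x + y)\<close> and
  \<open>k = ((x + y) / 2)\<^sup>3\<close>; then \<open>(x + y) / 2\<close> times \<open>1 + s\<close> or \<open>1 - s\<close> is \<open>x\<close> or \<open>y\<close>.
\<close>

lemma ordered_pair_eq_scaled_cubes:
  fixes a b :: real
  assumes "b > 0" "a > b"
  obtains k s where "k > 0" "0 < s" "s < 1" "a = k * (1 + s)^3" "b = k * (1 - s)^3"
proof
  define x where "x = root 3 a"
  define y where "y = root 3 b"
  have y: "y > 0" and xy: "x > y" and ab: "a = x^3" "b = y^3"
    using assms by (auto simp: x_def y_def)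
  show "((x + y) / 2)^3 > 0" "0 < (x - y) / (x + y)" "(x - y) / (x + y) < 1"
    using y xy by (auto simp: field_simps)
  have "x = (x + y) / 2 * (1 + (x - y) / (x + y))" "y = (x + y) / 2 * (1 - (x - y) / (x + y))"
    using y xy by (auto simp: field_simps)
  then show "a = ((x + y) / 2)^3 * (1 + (x - y) / (x + y))^3"
    "b = ((x + y) / 2)^3 * (1 - (x - y) / (x + y))^3"
    unfolding ab by (metis power_mult_distrib)+
qed

text \<open>
  For \<open>0 < s < 1\<close> this is \<open>ln (A / T)\<close> at \<open>((1 + s)\<^sup>3, (1 - s)\<^sup>3)\<close>, where \<open>A\<close> is the power mean of order
  \<open>5/3\<close> and \<open>T\<close> the second Seiffert mean. The explicit formula also makes sense at \<open>s = 1\<close>, which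
  supplies the limit for \<open>b \<rightarrow> 0\<close>.
\<close>

definition log_ratio :: "real \<Rightarrow> real" where
  "log_ratio s = ln (arctan ((3 * s + s^3) / (1 + 3 * s^2)))
     + 3/5 * ln (1 + 10 * s^2 + 5 * s^4) - ln (3 * s + s^3)"

lemma second_seiffert_mean_cubes:
  "second_seiffert_mean ((1 + s)^3) ((1 - s)^3)
     = (3 * s + s^3) / arctan ((3 * s + s^3) / (1 + 3 * s^2))"
proof -
  have d: "(1 + s)^3 - (1 - s)^3 = 2 * (3 * s + s^3)"
    and e: "(1 + s)^3 + (1 - s)^3 = 2 * (1 + 3 * s^2)"
    by algebra+
  show ?thesis
    unfolding second_seiffert_mean_def d e by (simp only: mult_divide_mult_cancel_left_if) simp
qed

lemma power_mean_cubes: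
  assumes "0 < s" "s < 1"
  shows "power_mean (5/3) ((1 + s)^3) ((1 - s)^3) = (1 + 10 * s^2 + 5 * s^4) powr (3/5)"
proof -
  have c: "(x^3) powr (5/3) = x^5" if "x > 0" for x :: real
  proof -
    have "(x^3) powr (5/3) = (x powr 3) powr (5/3)"
      using that by simp
    also have "\<dots> = x powr 5"
      by (simp only: powr_powr) simp
    also have "\<dots> = x^5"
      using that by simp
    finally show ?thesis .
  qed
  have e: "((1 + s)^5 + (1 - s)^5) / 2 = 1 + 10 * s^2 + 5 * s^4"
    by (simp add: field_simps) algebra
  show ?thesis
    using assms by (simp add: power_mean_def c e)
qed

lemma second_seiffert_mean_cubes_eq_exp:
  assumes "0 < s" "s < 1"
  shows "second_seiffert_mean ((1 + s)^3) ((1 - s)^3)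
    = exp (- log_ratio s) * power_mean (5/3) ((1 + s)^3) ((1 - s)^3)"
proof -
  have "3 * s + s^3 > 0" "1 + 10 * s^2 + 5 * s^4 > 0"
    and "arctan ((3 * s + s^3) / (1 + 3 * s^2)) > 0"
    using assms by (auto intro!: add_pos_pos divide_pos_pos)
  then have "exp (- log_ratio s) = (3 * s + s^3)
      / (arctan ((3 * s + s^3) / (1 + 3 * s^2)) * (1 + 10 * s^2 + 5 * s^4) powr (3/5))"
    and "(1 + 10 * s^2 + 5 * s^4) powr (3/5) > 0"
    unfolding log_ratio_def by (simp_all add: powr_def exp_add exp_diff exp_minus del: zero_less_arctan_iff)
  then show ?thesis
    using assms by (simp add: second_seiffert_mean_cubes power_mean_cubes)
qed

section \<open>Monotonicity of the logarithmic ratio\<close>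

text \<open>
  The argument is \<open>tanh (3 artanh s)\<close>, written as a rational function. The denominator of the
  derivative comes from \<open>(1 + 3 s\<^sup>2)\<^sup>2 + (3 s + s\<^sup>3)\<^sup>2 = (1 + s\<^sup>2) (1 + 14 s\<^sup>2 + s\<^sup>4)\<close>.
\<close>

lemma DERIV_arctan_cubic:
  "((\<lambda>s::real. arctan ((3 * s + s^3) / (1 + 3 * s^2))) has_real_derivative
     3 * (1 - s^2)^2 / ((1 + s^2) * (1 + 14 * s^2 + s^4))) (at s)"
proof -
  have p: "1 + 3 * s^2 > 0" "(1 + s^2) * (1 + 14 * s^2 + s^4) > 0"
    by (auto intro!: add_pos_nonneg mult_pos_pos)
  have "((\<lambda>s::real. arctan ((3 * s + s^3) / (1 + 3 * s^2))) has_real_derivative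
     inverse (1 + ((3 * s + s^3) / (1 + 3 * s^2))^2) *
     (((3 + 3 * s^2) * (1 + 3 * s^2) - (3 * s + s^3) * (6 * s)) / (1 + 3 * s^2)^2)) (at s)"
    using p by (auto intro!: derivative_eq_intros simp: power2_eq_square)
  also have "1 + ((3 * s + s^3) / (1 + 3 * s^2))^2
      = ((1 + s^2) * (1 + 14 * s^2 + s^4)) / (1 + 3 * s^2)^2"
  proof -
    have "(1 + 3 * s^2)^2 + (3 * s + s^3)^2 = (1 + s^2) * (1 + 14 * s^2 + s^4)"
      by algebra
    then show ?thesis
      using p by (simp add: power_divide add_divide_eq_iff)
  qed
  also have "(3 + 3 * s^2) * (1 + 3 * s^2) - (3 * s + s^3) * (6 * s) = 3 * (1 - s^2)^2"
    by algebra
  finally show ?thesis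
    using p by simp
qed

text \<open>
  The right-hand side is what the arctangent must stay below for the derivative of \<open>log_ratio\<close> to be positive.
  Both sides vanish at \<open>0\<close>, so it is enough to compare derivatives. Their difference is rational, and
  its numerator factors into terms that are visibly positive for \<open>0 < s < 1\<close>.
\<close>

lemma arctan_cubic_less:
  fixes s :: real
  assumes "0 < s" "s < 1"
  shows "arctan ((3 * s + s^3) / (1 + 3 * s^2))
    < s * (3 + s^2) * (1 + 10 * s^2 + 5 * s^4) / ((1 + s^2)^2 * (1 + 14 * s^2 + s^4))"
proof -
  let ?N = "\<lambda>s::real. s * (3 + s^2) * (1 + 10 * s^2 + 5 * s^4)"
  let ?D = "\<lambda>s::real. (1 + s^2)^2 * (1 + 14 * s^2 + s^4)"
  let ?G = "\<lambda>s. ?N s / ?D s - arctan ((3 * s + s^3) / (1 + 3 * s^2))"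
  let ?G' = "\<lambda>s::real. 8 * s^4 * (1 - s^2) * (3 + s^2) * (13 + 15 * s^2 + 3 * s^4 + s^6) / (?D s)^2"
  have G': "(?G has_real_derivative ?G' s) (at s)" for s
  proof -
    have p: "1 + s^2 > 0" "1 + 14 * s^2 + s^4 > 0"
      by (auto intro!: add_pos_nonneg)
    then have D: "?D s > 0"
      by simp
    \<comment> \<open>The derivatives of numerator and denominator in expanded form, which keeps the final
      polynomial identity free of derivative expressions.\<close>
    let ?N' = "3 + 93 * s^2 + 125 * s^4 + 35 * s^6"
    let ?D' = "32 * s + 120 * s^3 + 96 * s^5 + 8 * s^7"
    have N': "(?N has_real_derivative ?N') (at s)"
      by (auto intro!: derivative_eq_intros) algebra
    have D': "(?D has_real_derivative ?D') (at s)"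
      by (auto intro!: derivative_eq_intros) algebra
    have "(?G has_real_derivative (?N' * ?D s - ?N s * ?D') / (?D s * ?D s)
        - 3 * (1 - s^2)^2 / ((1 + s^2) * (1 + 14 * s^2 + s^4))) (at s)"
      using D by (intro DERIV_diff DERIV_divide N' D' DERIV_arctan_cubic) auto
    also have "3 * (1 - s^2)^2 / ((1 + s^2) * (1 + 14 * s^2 + s^4))
        = 3 * (1 - s^2)^2 * (1 + s^2) * ?D s / (?D s * ?D s)"
      using p by (simp add: power2_eq_square)
    also have "(?N' * ?D s - ?N s * ?D') / (?D s * ?D s)
          - 3 * (1 - s^2)^2 * (1 + s^2) * ?D s / (?D s * ?D s)
        = (?N' * ?D s - ?N s * ?D' - 3 * (1 - s^2)^2 * (1 + s^2) * ?D s) / (?D s * ?D s)"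
      by (simp only: diff_divide_distrib)
    also have "?N' * ?D s - ?N s * ?D' - 3 * (1 - s^2)^2 * (1 + s^2) * ?D s
        = 8 * s^4 * (1 - s^2) * (3 + s^2) * (13 + 15 * s^2 + 3 * s^4 + s^6)"
      by algebra
    finally show ?thesis
      by (simp only: power2_eq_square[of "?D s"])
  qed
  have "?G 0 < ?G s"
  proof (rule DERIV_pos_imp_increasing_open[OF assms(1)])
    show "\<exists>y. (?G has_real_derivative y) (at x) \<and> y > 0" if "0 < x" "x < s" for x
    proof (intro exI conjI)
      show "(?G has_real_derivative ?G' x) (at x)"
        by (rule G')
      have "x^2 < 1"
        using that assms by (simp add: power2_eq_square mult_strict_mono'[of x 1 x 1, simplified])
      moreover have "0 < 3 + x^2" "0 < 13 + 15 * x^2 + 3 * x^4 + x^6" "1 + x^2 > 0"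
        "1 + 14 * x^2 + x^4 > 0"
        by (auto intro!: add_pos_nonneg)
      ultimately show "?G' x > 0"
        using that by (intro divide_pos_pos mult_pos_pos zero_less_power) auto
    qed
    show "continuous_on {0..s} ?G"
      by (intro continuous_at_imp_continuous_on ballI DERIV_isCont[OF G'])
  qed
  then show ?thesis
    by simp
qed

text \<open>
  The two logarithms of polynomials contribute the single fraction that is subtracted: over the
  common denominator the numerators combine through
  \<open>4 s\<^sup>2 (3 + s\<^sup>2) - (1 + 10 s\<^sup>2 + 5 s\<^sup>4) = - (1 - s\<^sup>2)\<^sup>2\<close>. The factor \<open>(1 - s\<^sup>2)\<^sup>2\<close> is thus common
  to both summands and cancels in the sign question.
\<close>

lemma DERIV_log_ratio:
  assumes "0 < s"
  shows "(log_ratio has_real_derivative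
     3 * (1 - s^2)^2 / ((1 + s^2) * (1 + 14 * s^2 + s^4)) / arctan ((3 * s + s^3) / (1 + 3 * s^2))
     - 3 * (1 + s^2) * (1 - s^2)^2 / (s * (3 + s^2) * (1 + 10 * s^2 + 5 * s^4))) (at s)"
proof -
  have p: "1 + 10 * s^2 + 5 * s^4 > 0" "3 + s^2 > 0"
    by (auto intro!: add_pos_nonneg)
  have q: "3 * s + s^3 > 0" "arctan ((3 * s + s^3) / (1 + 3 * s^2)) > 0"
    using assms by (auto intro!: add_pos_pos divide_pos_pos)
  have 1: "((\<lambda>s. ln (1 + 10 * s^2 + 5 * s^4)) has_real_derivative
      (20 * s + 20 * s^3) / (1 + 10 * s^2 + 5 * s^4)) (at s)"
    using p by (auto intro!: derivative_eq_intros)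
  have 2: "((\<lambda>s. ln (3 * s + s^3)) has_real_derivative (3 + 3 * s^2) / (3 * s + s^3)) (at s)"
    using q by (auto intro!: derivative_eq_intros)
  have 3: "((\<lambda>s. ln (arctan ((3 * s + s^3) / (1 + 3 * s^2)))) has_real_derivative
      1 / arctan ((3 * s + s^3) / (1 + 3 * s^2))
      * (3 * (1 - s^2)^2 / ((1 + s^2) * (1 + 14 * s^2 + s^4)))) (at s)"
    using q by (intro DERIV_chain2[OF DERIV_ln_divide DERIV_arctan_cubic])
  have "(log_ratio has_real_derivative
      1 / arctan ((3 * s + s^3) / (1 + 3 * s^2))
        * (3 * (1 - s^2)^2 / ((1 + s^2) * (1 + 14 * s^2 + s^4)))
      + 3/5 * ((20 * s + 20 * s^3) / (1 + 10 * s^2 + 5 * s^4))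
      - (3 + 3 * s^2) / (3 * s + s^3)) (at s)"
    unfolding log_ratio_def by (intro DERIV_diff DERIV_add DERIV_cmult 1 2 3)
  moreover have "3/5 * ((20 * s + 20 * s^3) / (1 + 10 * s^2 + 5 * s^4))
      - (3 + 3 * s^2) / (3 * s + s^3)
      = - (3 * (1 + s^2) * (1 - s^2)^2 / (s * (3 + s^2) * (1 + 10 * s^2 + 5 * s^4)))"
    (is "?lhs = _")
  proof -
    let ?P = "1 + 10 * s^2 + 5 * s^4" and ?Q = "s * (3 + s^2)"
    have nz: "?P \<noteq> 0" "?Q \<noteq> 0"
      using p assms by auto
    have "3/5 * (20 * s + 20 * s^3) = 12 * (s + s^3)" "3 * s + s^3 = ?Q"
      by (simp, algebra)
    then have "?lhs = 12 * (s + s^3) / ?P - (3 + 3 * s^2) / ?Q"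
      by (simp only: times_divide_eq_right)
    also have "\<dots> = (12 * (s + s^3) * ?Q - (3 + 3 * s^2) * ?P) / (?P * ?Q)"
      by (rule diff_frac_eq[OF nz])
    also have "12 * (s + s^3) * ?Q - (3 + 3 * s^2) * ?P = - (3 * (1 + s^2) * (1 - s^2)^2)"
      by algebra
    finally show ?thesis
      by (simp only: minus_divide_left mult.commute[of ?P])
  qed
  ultimately show ?thesis
    by (simp only: add_diff_eq[symmetric] add_uminus_conv_diff times_divide_eq_left mult_1)
qed

lemma log_ratio_strict_mono:
  assumes "0 < r" "r < s" "s \<le> 1"
  shows "log_ratio r < log_ratio s"
proof (rule DERIV_pos_imp_increasing_open[OF assms(2)])
  fix x assume x: "r < x" "x < s"
  let ?t = "arctan ((3 * x + x^3) / (1 + 3 * x^2))"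
  let ?N = "x * (3 + x^2) * (1 + 10 * x^2 + 5 * x^4)"
  let ?D = "(1 + x^2) * (1 + 14 * x^2 + x^4)"
  have x01: "0 < x" "x < 1"
    using x assms by auto
  have pos: "?t > 0" "?N > 0" "?D > 0" "1 + x^2 > 0"
    using x01 by (auto intro!: add_pos_pos divide_pos_pos mult_pos_pos)
  have x2: "x^2 < 1"
    using x01 by (simp add: power2_eq_square mult_strict_mono'[of x 1 x 1, simplified])
  have "?t < ?N / ((1 + x^2) * ?D)"
    using arctan_cubic_less[OF x01] by (simp add: power2_eq_square[of "1 + x^2"] mult.assoc)
  then have "?t * ((1 + x^2) * ?D) < ?N"
    using pos by (simp add: pos_less_divide_eq)
  then have "(1 + x^2) * (?D * ?t) < ?N"
    by (simp only: mult_ac)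
  then have "1 + x^2 < ?N / (?D * ?t)"
    by (rule mult_imp_less_div_pos[OF mult_pos_pos[OF pos(3) pos(1)]])
  then have "(1 + x^2) / ?N < 1 / (?D * ?t)"
    by (intro mult_imp_div_pos_less pos) simp
  then have "(1 + x^2) / ?N < 1 / ?D / ?t"
    by (simp only: divide_divide_eq_left)
  then have "3 * (1 - x^2)^2 * ((1 + x^2) / ?N) < 3 * (1 - x^2)^2 * (1 / ?D / ?t)"
    using x2 by (intro mult_strict_left_mono) auto
  then have "3 * (1 - x^2)^2 / ?D / ?t - 3 * (1 + x^2) * (1 - x^2)^2 / ?N > 0"
    by (simp only: times_divide_eq_right mult_1_right diff_gt_0_iff_gt mult_ac)
  then show "\<exists>y. (log_ratio has_real_derivative y) (at x) \<and> y > 0"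
    using DERIV_log_ratio[OF x01(1)] by blast
next
  have "isCont log_ratio x" if "x \<in> {r..s}" for x
    using that assms DERIV_log_ratio[of x] by (intro DERIV_isCont) auto
  then show "continuous_on {r..s} log_ratio"
    by (simp add: continuous_at_imp_continuous_on)
qed

section \<open>Values at the ends and the two-sided bound\<close>

lemma log_ratio_tendsto_0: "(log_ratio \<longlongrightarrow> 0) (at_right 0)"
  unfolding log_ratio_def by real_asymp

text \<open>
  The limit at \<open>0\<close> is a lower bound of an increasing function; passing through \<open>s / 2\<close> makes it strict.
\<close>

lemma log_ratio_pos:
  assumes "0 < s" "s \<le> 1"
  shows "log_ratio s > 0"
proof -
  have "eventually (\<lambda>x. log_ratio x \<le> log_ratio (s/2)) (at_right 0)"
    unfolding eventually_at_right_field
    using assms by (intro exI[of _ "s/2"]) (auto intro!: less_imp_le log_ratio_strict_mono)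
  then have "0 \<le> log_ratio (s/2)"
    by (intro tendsto_upperbound[OF log_ratio_tendsto_0]) auto
  also have "\<dots> < log_ratio s"
    using assms by (intro log_ratio_strict_mono) auto
  finally show ?thesis .
qed

lemma exp_minus_log_ratio_1: "exp (- log_ratio 1) = 2 powr (8/5) * inverse pi"
proof -
  have "log_ratio 1 = ln pi - 8/5 * ln 2"
    using ln_realpow[of 2 2] ln_realpow[of 2 4]
    by (simp add: log_ratio_def arctan_one ln_div)
  then have "- log_ratio 1 = 8/5 * ln 2 + - ln pi"
    by simp
  then show ?thesis
    by (simp only: exp_add exp_minus) (simp add: powr_def)
qed

lemma second_seiffert_mean_bounds:
  assumes "a > 0" "b > 0" "a \<noteq> b"
  shows "2 powr (8/5) * inverse pi * power_mean (5/3) a b < second_seiffert_mean a b"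
    and "second_seiffert_mean a b < power_mean (5/3) a b"
proof -
  have *: "2 powr (8/5) * inverse pi * power_mean (5/3) a b < second_seiffert_mean a b
      \<and> second_seiffert_mean a b < power_mean (5/3) a b" if ab: "b > 0" "a > b" for a b
  proof -
    from ab obtain k s where ks: "k > 0" "0 < s" "s < 1" "a = k * (1 + s)^3" "b = k * (1 - s)^3"
      by (rule ordered_pair_eq_scaled_cubes)
    have T: "second_seiffert_mean a b = exp (- log_ratio s) * power_mean (5/3) a b"
      using ks by (simp add: second_seiffert_mean_scale power_mean_scale
          second_seiffert_mean_cubes_eq_exp)
    have "exp (- log_ratio 1) < exp (- log_ratio s)" "exp (- log_ratio s) < 1"
      using log_ratio_strict_mono[of s 1] log_ratio_pos[of s] ks by auto
    then show ?thesis
      using ab power_mean_pos[of a b "5/3"] unfolding T exp_minus_log_ratio_1[symmetric]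
      by (simp add: mult_less_cancel_right)
  qed
  have "2 powr (8/5) * inverse pi * power_mean (5/3) a b < second_seiffert_mean a b
      \<and> second_seiffert_mean a b < power_mean (5/3) a b"
  proof (cases "a > b")
    case True
    then show ?thesis
      using * assms by blast
  next
    case False
    then show ?thesis
      using *[of a b] assms second_seiffert_mean_commute[of a b] power_mean_commute[of "5/3" a b]
      by auto
  qed
  then show "2 powr (8/5) * inverse pi * power_mean (5/3) a b < second_seiffert_mean a b"
    and "second_seiffert_mean a b < power_mean (5/3) a b"
    by auto
qed

section \<open>Orders below the critical one\<close>

text \<open>
  The limit is the difference of the second-order coefficients of the two means near the diagonal,
  \<open>(p - 1) / 2\<close> for the power mean and \<open>1/3\<close> for the Seiffert mean.
\<close>

lemma power_mean_minus_second_seiffert_mean_tendsto: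
  assumes "p < 5/3"
  shows "((\<lambda>t. (power_mean p (1 + t) (1 - t) - second_seiffert_mean (1 + t) (1 - t)) / t^2)
    \<longlongrightarrow> (p - 1) / 2 - 1/3) (at_right 0)"
proof (cases "p = 0")
  case True
  have "((\<lambda>t::real. (sqrt ((1 + t) * (1 - t)) - t / arctan t) / t^2) \<longlongrightarrow> -5/6) (at_right 0)"
    by real_asymp
  then show ?thesis
    using True by (simp add: power_mean_def second_seiffert_mean_def)
next
  case False
  have "((\<lambda>t. (((((1 + t) powr p + (1 - t) powr p) / 2) powr (1/p)) - t / arctan t) / t^2)
      \<longlongrightarrow> (p - 1) / 2 - 1/3) (at_right 0)"
    using False assms by real_asymp
  then show ?thesis
    using False by (simp add: power_mean_def second_seiffert_mean_def)
qed

lemma exists_power_mean_less_second_seiffert_mean: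
  assumes "p < 5/3"
  obtains a b where "a > 0" "b > 0" "a \<noteq> b" "power_mean p a b < second_seiffert_mean a b"
proof -
  have "(p - 1) / 2 - 1/3 < 0"
    using assms by simp
  then have "eventually (\<lambda>t. (power_mean p (1 + t) (1 - t)
      - second_seiffert_mean (1 + t) (1 - t)) / t^2 < 0) (at_right 0)"
    using order_tendstoD(2)[OF power_mean_minus_second_seiffert_mean_tendsto[OF assms]] by blast
  moreover have "eventually (\<lambda>t::real. t \<in> {0<..<1}) (at_right 0)"
    by (rule eventually_at_right_real) simp
  ultimately have "eventually (\<lambda>t. t \<in> {0<..<1} \<and> (power_mean p (1 + t) (1 - t)
      - second_seiffert_mean (1 + t) (1 - t)) / t^2 < 0) (at_right 0)"
    by (rule eventually_elim2) auto
  then obtain t where t: "t \<in> {0<..<1}"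
      "(power_mean p (1 + t) (1 - t) - second_seiffert_mean (1 + t) (1 - t)) / t^2 < 0"
    using eventually_happens'[OF trivial_limit_at_right_real] by blast
  then show thesis
    by (intro that[of "1 + t" "1 - t"]) (auto simp: divide_less_0_iff)
qed

section \<open>Optimality of the constants\<close>

text \<open>\<open>T / A\<close> approaches its infimum as \<open>s \<rightarrow> 1\<close>, that is as \<open>b / a \<rightarrow> 0\<close>.\<close>

lemma lower_constant_optimal:
  assumes "c > 2 powr (8/5) * inverse pi"
  obtains a b where "a > 0" "b > 0" "a \<noteq> b"
    "second_seiffert_mean a b < c * power_mean (5/3) a b"
proof -
  have "isCont log_ratio 1"
    using DERIV_log_ratio[of 1] by (intro DERIV_isCont) auto
  then have "((\<lambda>s. exp (- log_ratio s)) \<longlongrightarrow> exp (- log_ratio 1)) (at_left 1)"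
    by (intro tendsto_intros) (simp add: isCont_def filterlim_at_split)
  then have "eventually (\<lambda>s. exp (- log_ratio s) < c) (at_left 1)"
    by (rule order_tendstoD(2)) (simp add: exp_minus_log_ratio_1 assms)
  moreover have "eventually (\<lambda>s::real. s \<in> {0<..<1}) (at_left 1)"
    by (rule eventually_at_left_real) simp
  ultimately have "eventually (\<lambda>s. exp (- log_ratio s) < c \<and> s \<in> {0<..<1}) (at_left 1)"
    by (rule eventually_conj)
  then obtain s where s: "exp (- log_ratio s) < c" "0 < s" "s < 1"
    using eventually_happens'[OF trivial_limit_at_left_real] by fastforce
  show thesis
  proof (rule that)
    show "(1 + s)^3 > 0" "(1 - s)^3 > 0" "(1 + s)^3 \<noteq> (1 - s)^3"
      using s power_strict_mono[of "1 - s" "1 + s" 3] by auto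
    then show "second_seiffert_mean ((1 + s)^3) ((1 - s)^3)
        < c * power_mean (5/3) ((1 + s)^3) ((1 - s)^3)"
      using s by (simp add: second_seiffert_mean_cubes_eq_exp power_mean_pos)
  qed
qed

text \<open>\<open>T / A\<close> approaches its supremum as \<open>s \<rightarrow> 0\<close>, that is near the diagonal.\<close>

lemma upper_constant_optimal:
  assumes "c < 1"
  obtains a b where "a > 0" "b > 0" "a \<noteq> b"
    "c * power_mean (5/3) a b < second_seiffert_mean a b"
proof -
  have "((\<lambda>s. exp (- log_ratio s)) \<longlongrightarrow> exp (- 0)) (at_right 0)"
    by (intro tendsto_intros log_ratio_tendsto_0)
  then have "eventually (\<lambda>s. c < exp (- log_ratio s)) (at_right 0)"
    by (rule order_tendstoD(1)) (simp add: assms)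
  moreover have "eventually (\<lambda>s::real. s \<in> {0<..<1}) (at_right 0)"
    by (rule eventually_at_right_real) simp
  ultimately have "eventually (\<lambda>s. c < exp (- log_ratio s) \<and> s \<in> {0<..<1}) (at_right 0)"
    by (rule eventually_conj)
  then obtain s where s: "c < exp (- log_ratio s)" "0 < s" "s < 1"
    using eventually_happens'[OF trivial_limit_at_right_real] by fastforce
  show thesis
  proof (rule that)
    show "(1 + s)^3 > 0" "(1 - s)^3 > 0" "(1 + s)^3 \<noteq> (1 - s)^3"
      using s power_strict_mono[of "1 - s" "1 + s" 3] by auto
    then show "c * power_mean (5/3) ((1 + s)^3) ((1 - s)^3)
        < second_seiffert_mean ((1 + s)^3) ((1 - s)^3)"
      using s by (simp add: second_seiffert_mean_cubes_eq_exp power_mean_pos)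
  qed
qed

section \<open>The sharp inequalities\<close>

theorem theorem1p1:
  fixes p :: real
  shows "((\<forall>a>0. \<forall>b>0. a \<noteq> b \<longrightarrow> second_seiffert_mean a b < power_mean p a b) \<longleftrightarrow> p \<ge> 5/3)
    \<and> (\<forall>a>0. \<forall>b>0. a \<noteq> b \<longrightarrow>
          2 powr (8/5) * inverse pi * power_mean (5/3) a b < second_seiffert_mean a b
        \<and> second_seiffert_mean a b < 1 * power_mean (5/3) a b)
    \<and> (\<forall>c > 2 powr (8/5) * inverse pi.
          \<not> (\<forall>a>0. \<forall>b>0. a \<noteq> b \<longrightarrow> c * power_mean (5/3) a b < second_seiffert_mean a b))
    \<and> (\<forall>c < 1.
          \<not> (\<forall>a>0. \<forall>b>0. a \<noteq> b \<longrightarrow> second_seiffert_mean a b < c * power_mean (5/3) a b))"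
proof (intro conjI iffI)
  assume *: "\<forall>a>0. \<forall>b>0. a \<noteq> b \<longrightarrow> second_seiffert_mean a b < power_mean p a b"
  show "p \<ge> 5/3"
  proof (rule ccontr)
    assume "\<not> p \<ge> 5/3"
    then obtain a b where "a > 0" "b > 0" "a \<noteq> b" "power_mean p a b < second_seiffert_mean a b"
      using exists_power_mean_less_second_seiffert_mean[of p] by auto
    then show False
      using * by (meson less_asym)
  qed
next
  assume "p \<ge> 5/3"
  then show "\<forall>a>0. \<forall>b>0. a \<noteq> b \<longrightarrow> second_seiffert_mean a b < power_mean p a b"
    using second_seiffert_mean_bounds(2) power_mean_mono[of "5/3" p]
    by (meson less_le_trans zero_less_divide_iff zero_less_numeral)
next
  show "\<forall>a>0. \<forall>b>0. a \<noteq> b \<longrightarrow>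
          2 powr (8/5) * inverse pi * power_mean (5/3) a b < second_seiffert_mean a b
        \<and> second_seiffert_mean a b < 1 * power_mean (5/3) a b"
    using second_seiffert_mean_bounds by simp
next
  show "\<forall>c > 2 powr (8/5) * inverse pi.
          \<not> (\<forall>a>0. \<forall>b>0. a \<noteq> b \<longrightarrow> c * power_mean (5/3) a b < second_seiffert_mean a b)"
    by (meson lower_constant_optimal less_asym)
next
  show "\<forall>c < 1.
          \<not> (\<forall>a>0. \<forall>b>0. a \<noteq> b \<longrightarrow> second_seiffert_mean a b < c * power_mean (5/3) a b)"
    by (meson upper_constant_optimal less_asym)
qed

end
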